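(* Let $f:Q\to\mathbb{R}$ be Lipschitz continuous with constant $M_f>0$ and $\gamma$-quasar convex with center $x_*$, $\gamma\in(0,1]$, and let $g_i:Q\to\mathbb{R}$, $i=1,\dots,m$, be convex and Lipschitz continuous with constants $M_{g_i}>0$, where $x_*$ is a solution of $\min\{f(x): x\in Q,\ g_i(x)\le0,\ i=1,\dots,m\}$. Put $M_g=\max_{1\le i\le m}M_{g_i}$ and $g(x)=\max_{1\le i\le m}g_i(x)$, and assume that for all $x\in Q$, $\|\nabla f(x)\|_*\le M_f$ and $\|\nabla g_i(x)\|_*\le M_g$ for all $i=1,\dots,m$. Let $\Theta_0>0$ satisfy $\sup_{x,y\in Q}V(y,x)\le\Theta_0^2$, let $\varepsilon>0$ and let $x_0\in Q$ be a starting point. Consider the following algorithm. For $k=0,1,2,\dots$: - if $g_i(x_k)\le\varepsilon$ for all $i=1,\dots,m$ (productive step), set $M_k=\|\nabla f(x_k)\|_*$, $h_k=\frac{\gamma\varepsilon}{M_k^2}$, $x_{k+1}=\operatorname{Mirr}_{x_k}(h_k\nabla f(x_k))$; - otherwise (non-productive step), take some $q(k)\in\{1,\dots,m\}$ with $g_{q(k)}(x_k)>\varepsilon$ and set $M_k=\|\nabla g_{q(k)}(x_k)\|_*$, $h_k=\frac{\gamma\varepsilon}{M_k^2}$, $x_{k+1}=\operatorname{Mirr}_{x_k}(h_k\nabla g_{q(k)}(x_k))$. The algorithm stops after the first number $k$ of performed iterations (indexed $0,\dots,k-1$) for which $$\sum_{i=0}^{k-1}\frac1{M_i^2}\ \ge\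 \frac{2\Theta_0^2}{\gamma^2\varepsilon^2}\Big(1+\frac1\gamma\Big)^2.$$ Let $I$ be the set of indices of productive steps among $0,\dots,k-1$. Then $I\neq\emptyset$, the algorithm stops after not more than $$\left\lceil\frac{2\Theta_0^2\max\{M_f^2,M_g^2\}}{\gamma^2\varepsilon^2}\Big(1+\frac1\gamma\Big)^2\right\rceil$$ iterations, and it returns $\hat x=\arg\min_{i\in I}f(x_i)$ (a point $x_i$, $i\in I$, with the smallest value of $f$) such that $f(\hat x)-f(x_* )\le\varepsilon$ and $g(\hat x)\le\varepsilon$.
   Context: $(\mathbf{E},\|\cdot\|)$ is a finite-dimensional normed space with dual $\mathbf{E}^*$ and dual norm $\|y\|_*=\max\{\langle y,x\rangle:\|x\|\le1\}$. $Q\subset\mathbf{E}$ is closed and convex. $d:Q\to\mathbb{R}$ is a proper, closed, differentiable function that is $1$-strongly convex with respect to $\|\cdot\|$ (prox-function). The Bregman divergence is $V(y,x)=d(y)-d(x)-\langle\nabla d(x),y-x\rangle$, $x,y\in Q$; it satisfies $V(y,x)\ge\frac12\|y-x\|^2$. The proximal mapping is $\operatorname{Mirr}_x(p)=\arg\min_{u\in Q}\{\langle p,u\rangle+V(u,x)\}$ for $x\in Q$, $p\in\mathbf{E}^*$. For a function $\phi$ on $Q$, $\nabla\phi(x)\in\partial\phi(x)$ denotes an arbitrary (sub)gradient of $\phi$ at $x$. A function $\phi$ is Lipschitz continuous with constant $M$ if $|\phi(x)-\phi(y)|\le M\|x-y\|$ for all $x,y\in Q$. For $\gamma\in(0,1]$,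 $f:Q\to\mathbb{R}$ is $\gamma$-quasar convex with center $x_*\in Q$ if $x_*\in\arg\min_{x\in Q}f(x)$ and $f(x_* )\ge f(x)+\frac1\gamma\langle\nabla f(x),x_*-x\rangle$ for all $x\in Q$. The problem is assumed feasible (regular): there is a point $\bar x$ in the interior of $Q$ with $g(\bar x)\le0$. The step sizes are understood to be well defined ($M_k\neq0$ at every iteration). *)

theory Defs
  imports "HOL-Analysis.Analysis"
begin

text \<open>
  The space is a type of class \<^class>\<open>real_normed_vector\<close>, so its norm is arbitrary (it need not
  come from an inner product). Its dual is the type of bounded linear functionals, which are all
  linear functionals when the space is finite-dimensional; the library norm on that type is the
  operator norm, that is, the dual norm:
\<close>

lemma dual_norm_eq_SUP:
  fixes p :: "'a::real_normed_vector \<Rightarrow>\<^sub>L real"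
  shows "norm p = (SUP x\<in>{x. norm x \<le> 1}. blinfun_apply p x)"
proof (rule antisym)
  let ?S = "SUP x\<in>{x. norm x \<le> 1}. blinfun_apply p x"
  have le: "blinfun_apply p x \<le> norm p" if "norm x \<le> 1" for x
    using norm_blinfun[of p x] mult_left_mono[OF that, of "norm p"] by simp
  have bdd: "bdd_above (blinfun_apply p ` {x. norm x \<le> 1})"
    by (rule bdd_aboveI2[where M = "norm p"]) (simp add: le)
  have up: "blinfun_apply p x \<le> ?S" if "norm x \<le> 1" for x
    using that bdd by (intro cSUP_upper) auto
  have S0: "0 \<le> ?S"
    using up[of 0] by (simp add: blinfun.zero_right)
  show "norm p \<le> ?S"
  proof (rule norm_blinfun_bound[OF S0])
    fix x :: 'a
    show "norm (blinfun_apply p x) \<le> ?S * norm x"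
    proof (cases "x = 0")
      case True
      then show ?thesis by (simp add: blinfun.zero_right)
    next
      case False
      have "blinfun_apply p (x /\<^sub>R norm x) \<le> ?S" "blinfun_apply p (- x /\<^sub>R norm x) \<le> ?S"
        using False by (auto intro!: up)
      then have "\<bar>blinfun_apply p x\<bar> / norm x \<le> ?S"
        by (simp add: blinfun.scaleR_right blinfun.minus_right abs_if divide_inverse mult.commute)
      then show ?thesis
        using False by (simp add: divide_le_eq)
    qed
  qed
  show "?S \<le> norm p"
    by (rule cSUP_least) (auto intro: le exI[of _ 0])
qed

definition strongly_convex_on :: "real \<Rightarrow> 'a::real_normed_vector set \<Rightarrow> ('a \<Rightarrow> real) \<Rightarrow> bool" where
  "strongly_convex_on \<mu> Q d \<longleftrightarrow> convex Q \<and>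
     (\<forall>x\<in>Q. \<forall>y\<in>Q. \<forall>t\<in>{0..1}.
        d ((1 - t) *\<^sub>R x + t *\<^sub>R y) \<le> (1 - t) * d x + t * d y - \<mu> / 2 * t * (1 - t) * (norm (x - y))\<^sup>2)"

text \<open>
  All real functions on \<open>Q\<close> are total functions on the type of which only the values on \<open>Q\<close> matter.
  Properness amounts to \<open>Q \<noteq> {}\<close>. Differentiability at a (possibly boundary) point of \<open>Q\<close> is
  differentiability relative to \<open>Q\<close>; the derivative is unique if \<open>Q\<close> is convex with nonempty interior.
\<close>

definition prox_function :: "'a::real_normed_vector set \<Rightarrow> ('a \<Rightarrow> real) \<Rightarrow> bool" where
  "prox_function Q d \<longleftrightarrow>
     Q \<noteq> {} \<and> closed (epigraph Q d) \<and> d differentiable_on Q \<and> strongly_convex_on 1 Q d"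

definition bregman :: "'a::real_normed_vector set \<Rightarrow> ('a \<Rightarrow> real) \<Rightarrow> 'a \<Rightarrow> 'a \<Rightarrow> real" where
  "bregman Q d y x = d y - d x - frechet_derivative d (at x within Q) (y - x)"

definition Mirr ::
    "'a::real_normed_vector set \<Rightarrow> ('a \<Rightarrow> real) \<Rightarrow> 'a \<Rightarrow> ('a \<Rightarrow>\<^sub>L real) \<Rightarrow> 'a" where
  "Mirr Q d x p = arg_min (\<lambda>u. blinfun_apply p u + bregman Q d u x) (\<lambda>u. u \<in> Q)"

definition convex_subdifferential ::
    "'a::real_normed_vector set \<Rightarrow> ('a \<Rightarrow> real) \<Rightarrow> 'a \<Rightarrow> ('a \<Rightarrow>\<^sub>L real) set" where
  "convex_subdifferential Q \<phi> x = {p. \<forall>y\<in>Q. \<phi> y \<ge> \<phi> x + blinfun_apply p (y - x)}"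

text \<open>
  A quasar-convex function is in general neither convex nor differentiable, and no particular notion
  of subdifferential is prescribed for it. We therefore work with an arbitrary assignment
  \<open>\<phi> \<mapsto> \<partial>\<phi>\<close>, of which we only require that it is the usual subdifferential of convex analysis
  whenever \<open>\<phi>\<close> is convex on \<open>Q\<close>.
\<close>

definition subdifferential_notion ::
    "'a::real_normed_vector set \<Rightarrow> (('a \<Rightarrow> real) \<Rightarrow> 'a \<Rightarrow> ('a \<Rightarrow>\<^sub>L real) set) \<Rightarrow> bool" where
  "subdifferential_notion Q subdiff \<longleftrightarrow>
     (\<forall>\<phi>. convex_on Q \<phi> \<longrightarrow> (\<forall>x\<in>Q. subdiff \<phi> x = convex_subdifferential Q \<phi> x))"

text \<open>Here \<open>f'\<close> is the chosen (sub)gradient, that is, \<open>f' x\<close> is an element of \<open>\<partial>f(x)\<close>.\<close>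

definition quasar_convex ::
    "'a::real_normed_vector set \<Rightarrow> ('a \<Rightarrow> real) \<Rightarrow> ('a \<Rightarrow> 'a \<Rightarrow>\<^sub>L real) \<Rightarrow> real \<Rightarrow> 'a \<Rightarrow> bool" where
  "quasar_convex Q f f' \<gamma> xs \<longleftrightarrow>
     0 < \<gamma> \<and> \<gamma> \<le> 1 \<and> is_arg_min f (\<lambda>x. x \<in> Q) xs \<and>
     (\<forall>x\<in>Q. f xs \<ge> f x + (1 / \<gamma>) * blinfun_apply (f' x) (xs - x))"

definition stop_criterion :: "real \<Rightarrow> real \<Rightarrow> real \<Rightarrow> (nat \<Rightarrow> real) \<Rightarrow> nat \<Rightarrow> bool" where
  "stop_criterion \<Theta>\<^sub>0 \<gamma> \<epsilon> M k \<longleftrightarrow>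
     (\<Sum>i<k. 1 / (M i)\<^sup>2) \<ge> 2 * \<Theta>\<^sub>0\<^sup>2 / (\<gamma>\<^sup>2 * \<epsilon>\<^sup>2) * (1 + 1 / \<gamma>)\<^sup>2"

text \<open>
  Iteration \<open>k\<close> is carried out iff the criterion failed after each of \<open>0, \<dots>, k\<close> iterations.
\<close>

definition performed :: "real \<Rightarrow> real \<Rightarrow> real \<Rightarrow> (nat \<Rightarrow> real) \<Rightarrow> nat \<Rightarrow> bool" where
  "performed \<Theta>\<^sub>0 \<gamma> \<epsilon> M k \<longleftrightarrow> (\<forall>j\<le>k. \<not> stop_criterion \<Theta>\<^sub>0 \<gamma> \<epsilon> M j)"

definition productive :: "nat \<Rightarrow> (nat \<Rightarrow> 'a \<Rightarrow> real) \<Rightarrow> real \<Rightarrow> 'a \<Rightarrow> bool" where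
  "productive m g \<epsilon> x \<longleftrightarrow> (\<forall>i\<in>{1..m}. g i x \<le> \<epsilon>)"

end

theory Submission
  imports Defs
begin

text \<open>
  Write \<open>w k = 1 / (M k)\<^sup>2\<close>, let \<open>S\<close> be the sum of these weights over the performed iterations, and
  let \<open>p k\<close> be the subgradient used in iteration \<open>k\<close>, so that \<open>norm (p k) = M k\<close> and
  \<open>h k = \<gamma> * \<epsilon> * w k\<close>. The analysis of mirror descent (\<open>mirror_descent_regret\<close>, obtained by
  telescoping \<open>mirror_step\<close>) bounds the sum of the \<open>h k * p k (x k - xs)\<close> by
  \<open>(\<gamma> * \<epsilon>)\<^sup>2 * S / 2 + \<Theta>\<^sub>0\<^sup>2\<close>, because \<open>(h k * norm (p k))\<^sup>2 = (\<gamma> * \<epsilon>)\<^sup>2 * w k\<close>.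

  Suppose that no productive iterate is \<open>\<epsilon>\<close>-optimal; this covers the case that there is no
  productive iterate at all. Then \<open>p k (x k - xs) \<ge> \<gamma> * \<epsilon>\<close> in every iteration. In a productive one
  quasar-convexity gives \<open>\<gamma> * (f (x k) - f xs)\<close> as a lower bound; in a non-productive one convexity of
  the violated constraint, whose value is more than \<open>\<epsilon>\<close> at \<open>x k\<close> and at most \<open>0\<close> at \<open>xs\<close>, gives the
  lower bound \<open>\<epsilon> \<ge> \<gamma> * \<epsilon>\<close>. The sum is therefore at least \<open>(\<gamma> * \<epsilon>)\<^sup>2 * S\<close>, hence
  \<open>(\<gamma> * \<epsilon>)\<^sup>2 * S \<le> 2 * \<Theta>\<^sub>0\<^sup>2\<close>. This contradicts the stopping criterion, by which the left side
  exceeds the right one (\<open>stop_criterion_gt\<close>). So some productive iterate is \<open>\<epsilon>\<close>-optimal, and so is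
  a best one. The bound on the number of iterations holds because each adds at least
  \<open>1 / max (Mf\<^sup>2) (Mg\<^sup>2)\<close> to \<open>S\<close> (\<open>stopping_time_le\<close>).

  Two points need care. The proximal step is defined by a choice operator, so the minimum must be
  shown to be attained: strong convexity and the bound on the divergence make \<open>Q\<close> bounded, hence
  compact, as the space is finite-dimensional. And \<open>d\<close> is differentiable only relative to \<open>Q\<close>, so
  its derivative at a boundary point may be an arbitrary choice among several; it is only ever
  evaluated in directions \<open>y - u\<close> with \<open>y \<in> Q\<close>, where it is the one-sided directional derivative,
  and in the three-point identity, which needs no more than its linearity.
\<close>

section \<open>Compactness in finite-dimensional normed spaces\<close>

text \<open>
  Adding a vector \<open>b\<close> outside of a span whose balls are compact, hence closed, leaves \<open>b\<close> at a
  positive distance \<open>\<delta>\<close> from the span. So in a bounded vector \<open>t *\<^sub>R b + y\<close> both \<open>t\<close> and \<open>y\<close> are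
  bounded, and a ball of the larger span lies in the continuous image of a compact product.
\<close>

lemma compact_span_Int_cball:
  fixes B :: "'a::real_normed_vector set"
  assumes "finite B"
  shows "compact (span B \<inter> cball 0 R)"
  using assms
proof (induction B arbitrary: R rule: finite_induct)
  case empty
  show ?case by (simp add: Int_insert_left)
next
  case (insert b B)
  show ?case
  proof (cases "b \<in> span B")
    case True
    then show ?thesis using insert.IH by (simp add: span_redundant)
  next
    case False
    obtain \<delta> where \<delta>: "\<delta> > 0" "\<And>y. y \<in> span B \<Longrightarrow> norm (b + y) \<ge> \<delta>"
    proof -
      \<comment> \<open>Only vectors of norm at most \<open>norm b + 1\<close> can be at distance less than 1 from \<open>- b\<close>.\<close>
      let ?C = "span B \<inter> cball 0 (norm b + 1)"
      have "open (- ?C)" by (rule open_Compl[OF compact_imp_closed[OF insert.IH]])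
      moreover have "- b \<in> - ?C" using False span_neg[of "- b" B] by auto
      ultimately obtain e where e: "e > 0" "ball (- b) e \<subseteq> - ?C"
        using open_contains_ball by metis
      have "norm (b + y) \<ge> min e 1" if y: "y \<in> span B" for y
      proof (cases "norm y \<le> norm b + 1")
        case True
        then have "y \<notin> ball (- b) e" using e y by auto
        moreover have "norm (- b - y) = norm (b + y)"
          using norm_minus_cancel[of "b + y"] by simp
        ultimately show ?thesis by (simp add: dist_norm)
      next
        case False
        then show ?thesis using norm_diff_ineq[of y b] by (simp add: add.commute)
      qed
      then show ?thesis using that[of "min e 1"] e(1) by auto
    qed
    let ?T = "R / \<delta>"
    let ?K = "(\<lambda>(t, y). t *\<^sub>R b + y) ` ({- ?T..?T} \<times> (span B \<inter> cball 0 (R + ?T * norm b)))"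
    have "compact ?K"
      by (intro compact_continuous_image compact_Times insert.IH compact_Icc)
         (auto simp: case_prod_unfold intro!: continuous_intros)
    moreover have "span (insert b B) \<inter> cball 0 R = ?K \<inter> cball 0 R"
    proof (intro equalityI subsetI IntI)
      fix v assume v: "v \<in> span (insert b B) \<inter> cball 0 R"
      then obtain t where t: "v - t *\<^sub>R b \<in> span B" by (auto simp: span_insert)
      let ?y = "v - t *\<^sub>R b"
      have "\<bar>t\<bar> * \<delta> \<le> norm v"
      proof (cases "t = 0")
        case False
        have "\<delta> \<le> norm (b + (1 / t) *\<^sub>R ?y)" by (intro \<delta> span_scale t)
        also have "b + (1 / t) *\<^sub>R ?y = (1 / t) *\<^sub>R v"
          using False by (simp add: scaleR_diff_right)
        finally show ?thesis using False by (simp add: field_simps)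
      qed simp
      then have "\<bar>t\<bar> * \<delta> \<le> R" using v by simp
      then have T: "\<bar>t\<bar> \<le> ?T" using \<delta>(1) by (simp add: field_simps)
      moreover have "norm ?y \<le> R + ?T * norm b"
        using norm_triangle_ineq4[of v "t *\<^sub>R b"] v mult_right_mono[OF T, of "norm b"] by simp
      ultimately show "v \<in> ?K"
        using t by (intro image_eqI[of _ _ "(t, ?y)"]) auto
    next
      fix v assume "v \<in> ?K \<inter> cball 0 R"
      then show "v \<in> span (insert b B)"
        using span_mono[OF subset_insertI[of B b]]
        by (auto simp del: insert_iff intro!: span_add span_scale span_base[OF insertI1])
    qed auto
    ultimately show ?thesis by (simp add: compact_Int_closed)
  qed
qed

section \<open>One-sided directional derivatives on convex sets\<close>

lemma has_derivative_imp_directional: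
  fixes F :: "'a::real_normed_vector \<Rightarrow> real"
  assumes F: "(F has_derivative F') (at u within Q)" and Q: "convex Q" "u \<in> Q" "y \<in> Q"
  shows "((\<lambda>t. (F (u + t *\<^sub>R (y - u)) - F u) / t) \<longlongrightarrow> F' (y - u)) (at_right 0)"
proof -
  let ?l = "\<lambda>t::real. u + t *\<^sub>R (y - u)"
  have sub: "?l ` {0..1} \<subseteq> Q"
  proof clarify
    fix t :: real assume "t \<in> {0..1}"
    then have "(1 - t) *\<^sub>R u + t *\<^sub>R y \<in> Q" using Q by (simp add: convex_alt)
    then show "?l t \<in> Q" by (simp add: algebra_simps)
  qed
  have lin: "linear F'" using has_derivative_bounded_linear[OF F] by (rule bounded_linear.linear)
  have "(?l has_derivative (\<lambda>t. t *\<^sub>R (y - u))) (at 0 within {0..1})"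
    by (auto intro!: derivative_eq_intros)
  moreover have "(F has_derivative F') (at (?l 0) within ?l ` {0..1})"
    using has_derivative_subset[OF F sub] by simp
  ultimately have "(F \<circ> ?l has_derivative F' \<circ> (\<lambda>t. t *\<^sub>R (y - u))) (at 0 within {0..1})"
    by (rule diff_chain_within)
  moreover have "F' \<circ> (\<lambda>t. t *\<^sub>R (y - u)) = (*) (F' (y - u))"
    by (auto simp: linear_scale[OF lin])
  ultimately have "(F \<circ> ?l has_field_derivative F' (y - u)) (at 0 within {0..1})"
    by (simp add: has_field_derivative_def)
  then show ?thesis
    by (simp add: has_field_derivative_iff at_within_Icc_at_right)
qed

lemma directional_derivative_nonneg_at_minimum:
  fixes F :: "'a::real_normed_vector \<Rightarrow> real"
  assumes F: "(F has_derivative F') (at u within Q)" and Q: "convex Q" "y \<in> Q"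
    and min: "is_arg_min F (\<lambda>v. v \<in> Q) u"
  shows "F' (y - u) \<ge> 0"
proof (rule tendsto_lowerbound[OF has_derivative_imp_directional[OF F]])
  show u: "u \<in> Q" using min by (simp add: is_arg_min_def)
  have "(F (u + t *\<^sub>R (y - u)) - F u) / t \<ge> 0" if t: "0 < t" "t < 1" for t
  proof -
    have "(1 - t) *\<^sub>R u + t *\<^sub>R y \<in> Q" using Q u t by (simp add: convex_alt)
    then have "u + t *\<^sub>R (y - u) \<in> Q" by (simp add: algebra_simps)
    then show ?thesis using min t by (simp add: is_arg_min_linorder)
  qed
  then show "\<forall>\<^sub>F t in at_right 0. 0 \<le> (F (u + t *\<^sub>R (y - u)) - F u) / t"
    by (auto simp: eventually_at_right_field intro!: exI[of _ 1])
qed (use Q in auto)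

section \<open>The Bregman divergence\<close>

lemma prox_function_has_derivative:
  assumes "prox_function Q d" "u \<in> Q"
  shows "(d has_derivative frechet_derivative d (at u within Q)) (at u within Q)"
  using assms by (simp add: prox_function_def differentiable_on_def frechet_derivative_works)

lemma prox_function_convex: "prox_function Q d \<Longrightarrow> convex Q"
  by (simp add: prox_function_def strongly_convex_on_def)

text \<open>
  Divide the strong convexity inequality on the segment from \<open>x\<close> to \<open>y\<close> by \<open>t\<close> and let \<open>t\<close> tend
  to \<open>0\<close> from the right.
\<close>

lemma bregman_ge_norm_square:
  assumes d: "prox_function Q d" and xy: "x \<in> Q" "y \<in> Q"
  shows "bregman Q d y x \<ge> (norm (y - x))\<^sup>2 / 2"
proof -
  let ?D = "frechet_derivative d (at x within Q)"
  have "?D (y - x) \<le> d y - d x - (norm (y - x))\<^sup>2 / 2"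
  proof (rule tendsto_le[OF _ _ has_derivative_imp_directional[OF prox_function_has_derivative[OF d xy(1)]
            prox_function_convex[OF d] xy]])
    show "((\<lambda>t. d y - d x - (1 - t) / 2 * (norm (y - x))\<^sup>2) \<longlongrightarrow> d y - d x - (norm (y - x))\<^sup>2 / 2) (at_right 0)"
      by (auto intro!: tendsto_eq_intros)
    have "(d (x + t *\<^sub>R (y - x)) - d x) / t \<le> d y - d x - (1 - t) / 2 * (norm (y - x))\<^sup>2"
      if t: "0 < t" "t < 1" for t
    proof -
      have "d ((1 - t) *\<^sub>R x + t *\<^sub>R y)
          \<le> (1 - t) * d x + t * d y - 1 / 2 * t * (1 - t) * (norm (x - y))\<^sup>2"
        using d xy t unfolding prox_function_def strongly_convex_on_def by simp
      moreover have "(1 - t) *\<^sub>R x + t *\<^sub>R y = x + t *\<^sub>R (y - x)" by (simp add: algebra_simps)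
      ultimately have "d (x + t *\<^sub>R (y - x)) - d x
          \<le> (d y - d x - (1 - t) / 2 * (norm (y - x))\<^sup>2) * t"
        by (simp add: norm_minus_commute algebra_simps)
      then show ?thesis using t by (simp add: pos_divide_le_eq)
    qed
    then show "\<forall>\<^sub>F t in at_right 0. (d (x + t *\<^sub>R (y - x)) - d x) / t
        \<le> d y - d x - (1 - t) / 2 * (norm (y - x))\<^sup>2"
      by (auto simp: eventually_at_right_field intro!: exI[of _ 1])
  qed simp
  then show ?thesis by (simp add: bregman_def)
qed

lemma bregman_three_points:
  assumes "prox_function Q d" "x \<in> Q" "u \<in> Q"
  shows "bregman Q d y x - bregman Q d y u - bregman Q d u x
    = frechet_derivative d (at u within Q) (y - u) - frechet_derivative d (at x within Q) (y - u)"
proof -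
  let ?D = "frechet_derivative d (at x within Q)"
  have "linear ?D"
    using prox_function_has_derivative[OF assms(1,2)] has_derivative_bounded_linear bounded_linear.linear by blast
  then have "?D (y - x) = ?D (y - u) + ?D (u - x)"
    using linear_add[of ?D "y - u" "u - x"] by simp
  then show ?thesis by (simp add: bregman_def)
qed

lemma compact_if_bregman_bounded:
  assumes fin: "\<exists>B::'a::real_normed_vector set. finite B \<and> span B = UNIV"
    and Q: "closed Q" and d: "prox_function Q d"
    and bound: "\<And>y z. y \<in> Q \<Longrightarrow> z \<in> Q \<Longrightarrow> bregman Q d y z \<le> c"
  shows "compact (Q :: 'a set)"
proof -
  obtain B :: "'a set" where B: "finite B" "span B = UNIV" using fin by blast
  obtain z where z: "z \<in> Q" using d by (auto simp: prox_function_def)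
  have "bounded Q"
  proof (rule boundedI)
    fix y assume y: "y \<in> Q"
    have "(norm (y - z))\<^sup>2 \<le> 2 * c"
      using bregman_ge_norm_square[OF d z y] bound[OF y z] by simp
    then have "norm (y - z) \<le> sqrt (2 * c)" by (rule real_le_rsqrt)
    then show "norm y \<le> norm z + sqrt (2 * c)"
      using norm_triangle_sub[of y z] by simp
  qed
  then obtain R where "\<And>y. y \<in> Q \<Longrightarrow> norm y \<le> R" by (auto simp: bounded_iff)
  then have "Q = (span B \<inter> cball 0 R) \<inter> Q" using B by auto
  then show ?thesis using compact_Int_closed[OF compact_span_Int_cball[OF B(1)] Q] by metis
qed

section \<open>Mirror descent\<close>

lemma proximal_objective_has_derivative:
  assumes d: "prox_function Q d" and xu: "x \<in> Q" "u \<in> Q"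
  shows "((\<lambda>u. blinfun_apply p u + bregman Q d u x) has_derivative
    (\<lambda>v. blinfun_apply p v + (frechet_derivative d (at u within Q) v
       - frechet_derivative d (at x within Q) v))) (at u within Q)"
proof -
  have "bounded_linear (frechet_derivative d (at x within Q))"
    using prox_function_has_derivative[OF d xu(1)] by (rule has_derivative_bounded_linear)
  note D = bounded_linear.has_derivative[OF this]
  show ?thesis unfolding bregman_def
    by (rule derivative_eq_intros D prox_function_has_derivative[OF d xu(2)] refl | simp)+
qed

lemma Mirr_is_arg_min:
  assumes d: "prox_function Q d" and "compact Q" and x: "x \<in> Q"
  shows "is_arg_min (\<lambda>u. blinfun_apply p u + bregman Q d u x) (\<lambda>u. u \<in> Q) (Mirr Q d x p)"
proof -
  let ?F = "\<lambda>u. blinfun_apply p u + bregman Q d u x"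
  have "continuous_on Q ?F"
    unfolding continuous_on_eq_continuous_within
    using has_derivative_continuous[OF proximal_objective_has_derivative[OF d x]] by blast
  then have "\<exists>u. is_arg_min ?F (\<lambda>u. u \<in> Q) u"
    using continuous_attains_inf[of Q ?F] assms by (auto simp: is_arg_min_linorder)
  then show ?thesis unfolding Mirr_def arg_min_def by (rule someI_ex)
qed

text \<open>
  Let \<open>u\<close> be the new point. By the three-point identity, first-order optimality of \<open>u\<close> in the
  direction of \<open>y\<close> bounds \<open>p (u - y)\<close> by \<open>bregman Q d y x - bregman Q d y u - bregman Q d u x\<close>. The
  remaining part \<open>p (x - u)\<close> is at most \<open>norm p * norm (u - x)\<close>, which Young's inequality splits into
  \<open>(norm p)\<^sup>2 / 2\<close> and a term that the negative \<open>bregman Q d u x\<close> absorbs.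
\<close>

lemma mirror_step:
  assumes d: "prox_function Q d" and Q: "compact Q" and xy: "x \<in> Q" "y \<in> Q"
  shows "blinfun_apply p (x - y)
    \<le> (norm p)\<^sup>2 / 2 + bregman Q d y x - bregman Q d y (Mirr Q d x p)"
proof -
  define u where "u = Mirr Q d x p"
  have u: "is_arg_min (\<lambda>u. blinfun_apply p u + bregman Q d u x) (\<lambda>u. u \<in> Q) u"
    unfolding u_def by (rule Mirr_is_arg_min[OF d Q xy(1)])
  then have uQ: "u \<in> Q" by (simp add: is_arg_min_def)
  have "0 \<le> blinfun_apply p (y - u) + (bregman Q d y x - bregman Q d y u - bregman Q d u x)"
    using directional_derivative_nonneg_at_minimum[OF proximal_objective_has_derivative[OF d xy(1) uQ]
        prox_function_convex[OF d] xy(2) u]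
    by (simp add: bregman_three_points[OF d xy(1) uQ])
  moreover have "blinfun_apply p (x - u) \<le> (norm p)\<^sup>2 / 2 + bregman Q d u x"
  proof -
    have "blinfun_apply p (x - u) \<le> norm p * norm (u - x)"
      using norm_blinfun[of p "x - u"] by (simp add: norm_minus_commute)
    also have "\<dots> \<le> (norm p)\<^sup>2 / 2 + (norm (u - x))\<^sup>2 / 2"
      using sum_squares_bound[of "norm p" "norm (u - x)"] by simp
    also have "\<dots> \<le> (norm p)\<^sup>2 / 2 + bregman Q d u x"
      using bregman_ge_norm_square[OF d xy(1) uQ] by simp
    finally show ?thesis .
  qed
  ultimately show ?thesis
    unfolding u_def[symmetric] by (simp add: blinfun.diff_right)
qed

lemma mirror_descent_iterate_mem:
  assumes d: "prox_function Q d" and Q: "compact Q" and x0: "x 0 \<in> Q"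
    and step: "\<And>k. k < N \<Longrightarrow> x (Suc k) = Mirr Q d (x k) (p k)"
  shows "k \<le> N \<Longrightarrow> x k \<in> Q"
proof (induction k)
  case (Suc k)
  then show ?case
    using Mirr_is_arg_min[OF d Q, of "x k" "p k"] step[of k] by (simp add: is_arg_min_def)
qed (rule x0)

text \<open>
  The divergences to \<open>y\<close> in the steps telescope; the last one is dropped as it is nonnegative.
\<close>

lemma mirror_descent_regret:
  assumes d: "prox_function Q d" and Q: "compact Q" and x0: "x 0 \<in> Q" and y: "y \<in> Q"
    and step: "\<And>k. k < N \<Longrightarrow> x (Suc k) = Mirr Q d (x k) (p k)"
  shows "(\<Sum>k<N. blinfun_apply (p k) (x k - y))
    \<le> (\<Sum>k<N. (norm (p k))\<^sup>2 / 2) + bregman Q d y (x 0)"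
proof -
  have in_Q: "x k \<in> Q" if "k \<le> N" for k
    using mirror_descent_iterate_mem[of Q d x N p, OF d Q x0 step that] .
  have "(\<Sum>k<N. blinfun_apply (p k) (x k - y))
      \<le> (\<Sum>k<N. (norm (p k))\<^sup>2 / 2 - (bregman Q d y (x (Suc k)) - bregman Q d y (x k)))"
  proof (rule sum_mono)
    fix k assume "k \<in> {..<N}"
    then show "blinfun_apply (p k) (x k - y)
        \<le> (norm (p k))\<^sup>2 / 2 - (bregman Q d y (x (Suc k)) - bregman Q d y (x k))"
      using mirror_step[OF d Q in_Q y, of k "p k"] step[of k] by simp
  qed
  also have "\<dots> = (\<Sum>k<N. (norm (p k))\<^sup>2 / 2) + bregman Q d y (x 0) - bregman Q d y (x N)"
    using sum_lessThan_telescope[of "\<lambda>k. bregman Q d y (x k)" N] by (simp add: sum_subtractf)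
  also have "\<dots> \<le> (\<Sum>k<N. (norm (p k))\<^sup>2 / 2) + bregman Q d y (x 0)"
    using bregman_ge_norm_square[OF d in_Q[OF order.refl] y] zero_le_power2[of "norm (y - x N)"]
    by linarith
  finally show "(\<Sum>k<N. blinfun_apply (p k) (x k - y))
      \<le> (\<Sum>k<N. (norm (p k))\<^sup>2 / 2) + bregman Q d y (x 0)" .
qed

section \<open>The stopping criterion\<close>

text \<open>
  As long as the criterion fails, each iteration adds at least \<open>1 / L\<close> to the sum, which therefore
  reaches a threshold \<open>C\<close> after at most \<open>\<lceil>C * L\<rceil>\<close> iterations.
\<close>

lemma stopping_time_le:
  assumes M: "\<And>k. performed \<Theta> \<gamma> \<epsilon> M k \<Longrightarrow> M k \<noteq> 0 \<and> (M k)\<^sup>2 \<le> L"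
  obtains N where "stop_criterion \<Theta> \<gamma> \<epsilon> M N" "\<forall>k<N. \<not> stop_criterion \<Theta> \<gamma> \<epsilon> M k"
    "int N \<le> \<lceil>2 * \<Theta>\<^sup>2 * L / (\<gamma>\<^sup>2 * \<epsilon>\<^sup>2) * (1 + 1 / \<gamma>)\<^sup>2\<rceil>"
proof -
  define C where "C = 2 * \<Theta>\<^sup>2 / (\<gamma>\<^sup>2 * \<epsilon>\<^sup>2) * (1 + 1 / \<gamma>)\<^sup>2"
  define K where "K = nat \<lceil>C * L\<rceil>"
  have "\<exists>k\<le>K. stop_criterion \<Theta> \<gamma> \<epsilon> M k"
  proof (rule ccontr)
    assume no: "\<not> ?thesis"
    then have M': "M k \<noteq> 0" "(M k)\<^sup>2 \<le> L" if "k \<le> K" for k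
      using M[of k] that by (auto simp: performed_def)
    have L: "L > 0" using M'[of 0] zero_less_power2[of "M 0"] by (smt (verit) le0)
    have "C * L \<le> real K" unfolding K_def by linarith
    then have "C \<le> (\<Sum>i<K. 1 / L)" using L by (simp add: pos_le_divide_eq)
    also have "\<dots> \<le> (\<Sum>i<K. 1 / (M i)\<^sup>2)"
      using M' L by (intro sum_mono divide_left_mono) auto
    finally have "stop_criterion \<Theta> \<gamma> \<epsilon> M K" by (simp add: stop_criterion_def C_def)
    then show False using no by blast
  qed
  then obtain k where k: "k \<le> K" "stop_criterion \<Theta> \<gamma> \<epsilon> M k" by blast
  define N where "N = (LEAST k. stop_criterion \<Theta> \<gamma> \<epsilon> M k)"
  have "N \<le> K" unfolding N_def using Least_le[of _ k] k by (meson order_trans)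
  \<comment> \<open>The sign of \<open>L\<close> is known only once an iteration has been performed; if there is none, the
      criterion already holds for the empty sum, and \<open>C\<close> vanishes.\<close>
  moreover have "0 \<le> C * L"
  proof (cases "\<exists>k. performed \<Theta> \<gamma> \<epsilon> M k")
    case True
    then obtain k where "(M k)\<^sup>2 \<le> L" using M by blast
    then have "0 \<le> L" using zero_le_power2 order_trans by blast
    then show ?thesis by (simp add: C_def)
  next
    case False
    then have "C \<le> 0" by (auto simp: performed_def stop_criterion_def C_def dest: spec[of _ 0])
    moreover have "0 \<le> C" by (simp add: C_def)
    ultimately show ?thesis by simp
  qed
  then have "int K = \<lceil>C * L\<rceil>" by (simp add: K_def)
  ultimately have "int N \<le> \<lceil>C * L\<rceil>" by linarith
  moreover have "C * L = 2 * \<Theta>\<^sup>2 * L / (\<gamma>\<^sup>2 * \<epsilon>\<^sup>2) * (1 + 1 / \<gamma>)\<^sup>2" by (simp add: C_def)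
  moreover have "stop_criterion \<Theta> \<gamma> \<epsilon> M N" unfolding N_def by (rule LeastI[of _ k]) (rule k)
  moreover have "\<forall>k<N. \<not> stop_criterion \<Theta> \<gamma> \<epsilon> M k" unfolding N_def using not_less_Least by blast
  ultimately show ?thesis using that by metis
qed

text \<open>
  The factor \<open>(1 + 1 / \<gamma>)\<^sup>2 > 1\<close> in the criterion makes the inequality strict.
\<close>

lemma stop_criterion_gt:
  assumes "stop_criterion \<Theta> \<gamma> \<epsilon> M N" "\<Theta> > 0" "\<gamma> > 0" "\<epsilon> > 0"
  shows "2 * \<Theta>\<^sup>2 < (\<gamma> * \<epsilon>)\<^sup>2 * (\<Sum>i<N. 1 / (M i)\<^sup>2)"
proof -
  have "1 < (1 + 1 / \<gamma>)\<^sup>2" using assms by (intro one_less_power) auto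
  then have "2 * \<Theta>\<^sup>2 / (\<gamma> * \<epsilon>)\<^sup>2 * 1 < 2 * \<Theta>\<^sup>2 / (\<gamma> * \<epsilon>)\<^sup>2 * (1 + 1 / \<gamma>)\<^sup>2"
    using assms by (intro mult_strict_left_mono) auto
  also have "\<dots> \<le> (\<Sum>i<N. 1 / (M i)\<^sup>2)"
    using assms by (simp add: stop_criterion_def power_mult_distrib)
  finally show ?thesis using assms by (simp add: pos_divide_less_eq mult.commute)
qed

section \<open>Convergence under quasar-convexity\<close>

theorem theorem4p4:
  fixes Q :: "'a::real_normed_vector set"
    and d f :: "'a \<Rightarrow> real"
    and g :: "nat \<Rightarrow> 'a \<Rightarrow> real"
    and subdiff :: "('a \<Rightarrow> real) \<Rightarrow> 'a \<Rightarrow> ('a \<Rightarrow>\<^sub>L real) set"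
    and f' :: "'a \<Rightarrow> 'a \<Rightarrow>\<^sub>L real"
    and g' :: "nat \<Rightarrow> 'a \<Rightarrow> 'a \<Rightarrow>\<^sub>L real"
    and m :: nat
    and xs :: 'a
    and \<gamma> \<epsilon> \<Theta>\<^sub>0 Mf Mg :: real
    and Mgi :: "nat \<Rightarrow> real"
    and x :: "nat \<Rightarrow> 'a"
    and q :: "nat \<Rightarrow> nat"
    and M h :: "nat \<Rightarrow> real"
  assumes finite_dim: "\<exists>B::'a set. finite B \<and> span B = UNIV"
    and Q: "closed Q" "convex Q"
    and prox: "prox_function Q d"
    and m: "m \<ge> 1"
    and subdiff: "subdifferential_notion Q subdiff"
    and f'_subgrad: "\<And>y. y \<in> Q \<Longrightarrow> f' y \<in> subdiff f y"
    and g'_subgrad: "\<And>i y. i \<in> {1..m} \<Longrightarrow> y \<in> Q \<Longrightarrow> g' i y \<in> subdiff (g i) y"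
    and f_lipschitz: "Mf > 0" "Mf-lipschitz_on Q f"
    and f_quasar: "quasar_convex Q f f' \<gamma> xs"
    and g_convex: "\<And>i. i \<in> {1..m} \<Longrightarrow> convex_on Q (g i)"
    and g_lipschitz: "\<And>i. i \<in> {1..m} \<Longrightarrow> Mgi i > 0"
      "\<And>i. i \<in> {1..m} \<Longrightarrow> (Mgi i)-lipschitz_on Q (g i)"
    and solution: "is_arg_min f (\<lambda>y. y \<in> Q \<and> (\<forall>i\<in>{1..m}. g i y \<le> 0)) xs"
    and regular: "\<exists>xbar \<in> interior Q. (MAX i\<in>{1..m}. g i xbar) \<le> 0"
    and Mg: "Mg = (MAX i\<in>{1..m}. Mgi i)"
    and f'_bound: "\<And>y. y \<in> Q \<Longrightarrow> norm (f' y) \<le> Mf"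
    and g'_bound: "\<And>i y. i \<in> {1..m} \<Longrightarrow> y \<in> Q \<Longrightarrow> norm (g' i y) \<le> Mg"
    and Theta: "\<Theta>\<^sub>0 > 0" "\<And>y z. y \<in> Q \<Longrightarrow> z \<in> Q \<Longrightarrow> bregman Q d y z \<le> \<Theta>\<^sub>0\<^sup>2"
    and eps: "\<epsilon> > 0"
    and start: "x 0 \<in> Q"
    and productive_step:
      "\<And>k. performed \<Theta>\<^sub>0 \<gamma> \<epsilon> M k \<Longrightarrow> productive m g \<epsilon> (x k) \<Longrightarrow>
         M k = norm (f' (x k)) \<and> h k = \<gamma> * \<epsilon> / (M k)\<^sup>2 \<and>
         x (Suc k) = Mirr Q d (x k) (h k *\<^sub>R f' (x k))"
    and nonproductive_step:
      "\<And>k. performed \<Theta>\<^sub>0 \<gamma> \<epsilon> M k \<Longrightarrow> \<not> productive m g \<epsilon> (x k) \<Longrightarrow>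
         q k \<in> {1..m} \<and> g (q k) (x k) > \<epsilon> \<and>
         M k = norm (g' (q k) (x k)) \<and> h k = \<gamma> * \<epsilon> / (M k)\<^sup>2 \<and>
         x (Suc k) = Mirr Q d (x k) (h k *\<^sub>R g' (q k) (x k))"
    and well_defined: "\<And>k. performed \<Theta>\<^sub>0 \<gamma> \<epsilon> M k \<Longrightarrow> M k \<noteq> 0"
  shows "\<exists>N I. stop_criterion \<Theta>\<^sub>0 \<gamma> \<epsilon> M N \<and> (\<forall>k<N. \<not> stop_criterion \<Theta>\<^sub>0 \<gamma> \<epsilon> M k) \<and>
           int N \<le> \<lceil>2 * \<Theta>\<^sub>0\<^sup>2 * max (Mf\<^sup>2) (Mg\<^sup>2) / (\<gamma>\<^sup>2 * \<epsilon>\<^sup>2) * (1 + 1 / \<gamma>)\<^sup>2\<rceil> \<and>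
           I = {k. k < N \<and> productive m g \<epsilon> (x k)} \<and> I \<noteq> {} \<and>
           (\<forall>i. is_arg_min (\<lambda>k. f (x k)) (\<lambda>k. k \<in> I) i \<longrightarrow>
              f (x i) - f xs \<le> \<epsilon> \<and> (MAX j\<in>{1..m}. g j (x i)) \<le> \<epsilon>)"
proof -
  have \<gamma>: "0 < \<gamma>" "\<gamma> \<le> 1" and xs: "xs \<in> Q" "\<And>i. i \<in> {1..m} \<Longrightarrow> g i xs \<le> 0"
    using f_quasar solution by (auto simp: quasar_convex_def is_arg_min_def)
  have cQ: "compact Q" by (rule compact_if_bregman_bounded[OF finite_dim Q(1) prox Theta(2)])
  define G where "G k = (if productive m g \<epsilon> (x k) then f' (x k) else g' (q k) (x k))" for k
  have step: "M k = norm (G k) \<and> h k = \<gamma> * \<epsilon> / (M k)\<^sup>2 \<and> x (Suc k) = Mirr Q d (x k) (h k *\<^sub>R G k)"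
    if "performed \<Theta>\<^sub>0 \<gamma> \<epsilon> M k" for k
    using that productive_step[of k] nonproductive_step[of k] by (auto simp: G_def)
  have performed_less: "performed \<Theta>\<^sub>0 \<gamma> \<epsilon> M j" if "performed \<Theta>\<^sub>0 \<gamma> \<epsilon> M k" "j \<le> k" for j k
    using that by (auto simp: performed_def)
  have x_Q: "x k \<in> Q" if "performed \<Theta>\<^sub>0 \<gamma> \<epsilon> M k" for k
    by (rule mirror_descent_iterate_mem[where N = k and p = "\<lambda>k. h k *\<^sub>R G k" and x = x,
          OF prox cQ start])
       (use step performed_less[OF that] in auto)
  have "M k \<noteq> 0 \<and> (M k)\<^sup>2 \<le> max (Mf\<^sup>2) (Mg\<^sup>2)" if k: "performed \<Theta>\<^sub>0 \<gamma> \<epsilon> M k" for k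
  proof -
    have "norm (G k) \<le> Mf \<or> norm (G k) \<le> Mg"
      using f'_bound g'_bound x_Q[OF k] nonproductive_step[OF k] by (auto simp: G_def)
    then have "(norm (G k))\<^sup>2 \<le> max (Mf\<^sup>2) (Mg\<^sup>2)"
      by (auto simp: le_max_iff_disj intro: power_mono)
    then show ?thesis using well_defined[OF k] step[OF k] by simp
  qed
  then obtain N where N: "stop_criterion \<Theta>\<^sub>0 \<gamma> \<epsilon> M N" "\<forall>k<N. \<not> stop_criterion \<Theta>\<^sub>0 \<gamma> \<epsilon> M k"
    "int N \<le> \<lceil>2 * \<Theta>\<^sub>0\<^sup>2 * max (Mf\<^sup>2) (Mg\<^sup>2) / (\<gamma>\<^sup>2 * \<epsilon>\<^sup>2) * (1 + 1 / \<gamma>)\<^sup>2\<rceil>"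
    by (rule stopping_time_le)
  have perf: "performed \<Theta>\<^sub>0 \<gamma> \<epsilon> M k" if "k < N" for k
    using N(2) that by (auto simp: performed_def)
  have "\<exists>k<N. productive m g \<epsilon> (x k) \<and> f (x k) - f xs \<le> \<epsilon>"
  proof (rule ccontr)
    assume bad: "\<not> ?thesis"
    let ?S = "\<Sum>k<N. 1 / (M k)\<^sup>2"
    \<comment> \<open>Both kinds of steps have the same lower bound, since \<open>\<gamma> \<le> 1\<close>.\<close>
    have gap: "\<gamma> * \<epsilon> \<le> blinfun_apply (G k) (x k - xs)" if k: "k < N" for k
    proof (cases "productive m g \<epsilon> (x k)")
      case True
      have "f xs \<ge> f (x k) + (1 / \<gamma>) * blinfun_apply (f' (x k)) (xs - x k)"
        using f_quasar x_Q[OF perf[OF k]] by (simp add: quasar_convex_def)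
      then have "\<gamma> * (f (x k) - f xs) \<le> blinfun_apply (f' (x k)) (x k - xs)"
        using \<gamma>(1) by (simp add: blinfun.diff_right field_simps)
      moreover have "\<gamma> * \<epsilon> \<le> \<gamma> * (f (x k) - f xs)"
        using bad True k \<gamma>(1) by (intro mult_left_mono) auto
      ultimately show ?thesis using True by (simp add: G_def)
    next
      case False
      note q = nonproductive_step[OF perf[OF k] False]
      have "g' (q k) (x k) \<in> convex_subdifferential Q (g (q k)) (x k)"
        using subdiff g_convex g'_subgrad q x_Q[OF perf[OF k]]
        by (simp add: subdifferential_notion_def)
      then have "g (q k) xs \<ge> g (q k) (x k) + blinfun_apply (g' (q k) (x k)) (xs - x k)"
        using xs(1) by (simp add: convex_subdifferential_def)
      then have "\<epsilon> \<le> blinfun_apply (G k) (x k - xs)"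
        using q xs(2)[of "q k"] False by (simp add: G_def blinfun.diff_right)
      moreover have "\<gamma> * \<epsilon> \<le> \<epsilon>" using \<gamma> eps by (simp add: mult_le_cancel_right1)
      ultimately show ?thesis by linarith
    qed
    have "(\<gamma> * \<epsilon>)\<^sup>2 * ?S \<le> (\<Sum>k<N. blinfun_apply (h k *\<^sub>R G k) (x k - xs))"
      unfolding sum_distrib_left
    proof (rule sum_mono)
      fix k assume "k \<in> {..<N}"
      then have k: "k < N" by simp
      have "(\<gamma> * \<epsilon>)\<^sup>2 * (1 / (M k)\<^sup>2) = \<gamma> * \<epsilon> / (M k)\<^sup>2 * (\<gamma> * \<epsilon>)" by (simp add: power2_eq_square)
      also have "\<dots> \<le> \<gamma> * \<epsilon> / (M k)\<^sup>2 * blinfun_apply (G k) (x k - xs)"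
        using gap[OF k] \<gamma> eps by (intro mult_left_mono) auto
      finally show "(\<gamma> * \<epsilon>)\<^sup>2 * (1 / (M k)\<^sup>2) \<le> blinfun_apply (h k *\<^sub>R G k) (x k - xs)"
        using step[OF perf[OF k]] by (simp add: blinfun.scaleR_left)
    qed
    also have "\<dots> \<le> (\<Sum>k<N. (norm (h k *\<^sub>R G k))\<^sup>2 / 2) + bregman Q d xs (x 0)"
      by (rule mirror_descent_regret[where x = x, OF prox cQ start xs(1)]) (use step perf in blast)
    also have "(\<Sum>k<N. (norm (h k *\<^sub>R G k))\<^sup>2 / 2) = (\<gamma> * \<epsilon>)\<^sup>2 / 2 * ?S"
      unfolding sum_distrib_left
    proof (rule sum.cong)
      fix k assume "k \<in> {..<N}"
      then have k: "performed \<Theta>\<^sub>0 \<gamma> \<epsilon> M k" using perf by simp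
      have "norm (h k *\<^sub>R G k) = \<bar>\<gamma> * \<epsilon> / (M k)\<^sup>2\<bar> * M k" using step[OF k] by simp
      then have "(norm (h k *\<^sub>R G k))\<^sup>2 = (\<gamma> * \<epsilon> / (M k)\<^sup>2 * M k)\<^sup>2"
        by (simp only: power_mult_distrib power2_abs)
      then show "(norm (h k *\<^sub>R G k))\<^sup>2 / 2 = (\<gamma> * \<epsilon>)\<^sup>2 / 2 * (1 / (M k)\<^sup>2)"
        using well_defined[OF k] by (simp add: power2_eq_square)
    qed simp
    also have "bregman Q d xs (x 0) \<le> \<Theta>\<^sub>0\<^sup>2" by (rule Theta(2)[OF xs(1) start])
    finally have "(\<gamma> * \<epsilon>)\<^sup>2 * ?S \<le> 2 * \<Theta>\<^sub>0\<^sup>2" by simp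
    then show False using stop_criterion_gt[OF N(1) Theta(1) \<gamma>(1) eps] by simp
  qed
  then obtain k where k: "k < N" "productive m g \<epsilon> (x k)" "f (x k) - f xs \<le> \<epsilon>" by blast
  have "f (x i) - f xs \<le> \<epsilon> \<and> (MAX j\<in>{1..m}. g j (x i)) \<le> \<epsilon>"
    if i: "is_arg_min (\<lambda>k. f (x k)) (\<lambda>k. k \<in> {k. k < N \<and> productive m g \<epsilon> (x k)}) i" for i
  proof
    show "f (x i) - f xs \<le> \<epsilon>" using i k by (auto simp: is_arg_min_linorder)
    show "(MAX j\<in>{1..m}. g j (x i)) \<le> \<epsilon>"
      using i m by (auto simp: is_arg_min_def productive_def intro!: Max.boundedI)
  qed
  then show ?thesis using N k by blast
qed

end
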